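(* Let $n\ge 4$ and let $K_{1,n-1}$ be the star graph with vertex set $\{1,2,\dots,n\}$ and edge set $\{\{1,i\}: i=2,\dots,n\}$. Then $\mathcal{T}_\ell(K_{1,n-1},1)\cong M_2(\mathbb{C})\oplus\mathbb{C}$ as $\mathbb{C}$-algebras for $\ell=1,2,3,4$.
   Context: For a finite connected simple graph $\Gamma=(X,E)$ with adjacency matrix $A$ and base vertex $x_0\in X$, $M_X(\mathbb{C})$ is the algebra of complex matrices with rows and columns indexed by $X$. For $Y\subset X$, $E_Y$ is the diagonal matrix with $(x,x)$-entry $1$ if $x\in Y$ and $0$ otherwise; $E_x=E_{\{x\}}$. $\mathbb{C}\langle S\rangle$ is the unital $\mathbb{C}$-subalgebra of $M_X(\mathbb{C})$ generated by $S$. Let $X_k=\{x\in X:\partial(x_0,x)=k\}$ ($\partial$ the graph distance), $D=\max_{x}\partial(x_0,x)$, $G_{x_0}$ the stabilizer of $x_0$ in $\mathrm{Aut}(\Gamma)$, and $Y_1,\dots,Y_r$ the $G_{x_0}$-orbits on $X$. Then $\mathcal{T}_1(\Gamma,x_0)=\mathbb{C}\langle A,E_{x_0}\rangle$, $\mathcal{T}_2(\Gamma,x_0)=\mathbb{C}\langle A,E_{X_0},\dots,E_{X_D}\rangle$, $\mathcal{T}_3(\Gamma,x_0)=\mathbb{C}\langle A,E_{Y_1},\dots,E_{Y_r}\rangle$, and $\mathcal{T}_4(\Gamma,x_0)=\{M\in M_X(\mathbb{C}): M_{\sigma(x),\sigma(y)}=M_{x,y}\ \text{for all } x,y\in X,\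 \sigma\in G_{x_0}\}$. *)

theory Defs
  imports Complex_Main "HOL-Algebra.Module" "HOL-Algebra.Subrings"
    "HOL-Algebra.Chinese_Remainder" "HOL-Combinatorics.Permutations"
begin

section \<open>Complex algebras\<close>

text \<open>
  An algebra over \<open>\<complex>\<close> is carried by the record type of HOL-Algebra's modules, which has the
  ring operations and a scalar multiplication. The locale \<open>algebra\<close> of HOL-Algebra is not used
  since it demands that multiplication be commutative.
\<close>

type_synonym 'a calg = "(complex, 'a) module"

definition unital_subalgebra :: "'a set \<Rightarrow> 'a calg \<Rightarrow> bool"
  where "unital_subalgebra B R \<longleftrightarrow> subring B R \<and> (\<forall>c. \<forall>a\<in>B. c \<odot>\<^bsub>R\<^esub> a \<in> B)"

definition alg_gen :: "'a calg \<Rightarrow> 'a set \<Rightarrow> 'a set"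
  where "alg_gen R S = \<Inter>{B. unital_subalgebra B R \<and> S \<subseteq> B}"

definition calg_iso :: "'a calg \<Rightarrow> 'b calg \<Rightarrow> bool"  (infix \<open>\<cong>\<^sub>\<complex>\<close> 50)
  where "R \<cong>\<^sub>\<complex> S \<longleftrightarrow>
    (\<exists>h\<in>ring_iso R S. \<forall>c. \<forall>a\<in>carrier R. h (c \<odot>\<^bsub>R\<^esub> a) = c \<odot>\<^bsub>S\<^esub> h a)"

definition direct_sum :: "'a calg \<Rightarrow> 'b calg \<Rightarrow> ('a \<times> 'b) calg"  (infixr \<open>\<oplus>\<^sub>\<complex>\<close> 65)
  where "R \<oplus>\<^sub>\<complex> S = ring.extend (RDirProd R S)
    \<lparr>smult = (\<lambda>c (a, b). (c \<odot>\<^bsub>R\<^esub> a, c \<odot>\<^bsub>S\<^esub> b))\<rparr>"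

definition complex_alg :: "complex calg"
  where "complex_alg = \<lparr>carrier = UNIV, monoid.mult = (*), monoid.one = 1, ring.zero = 0, ring.add = (+), smult = (*)\<rparr>"


section \<open>Matrices indexed by a finite set\<close>

text \<open>
  A matrix with rows and columns indexed by \<open>X\<close> is a function of two arguments that vanishes
  unless both lie in \<open>X\<close>, so that equality of matrices is equality of functions.
\<close>

type_synonym 'a cmat = "'a \<Rightarrow> 'a \<Rightarrow> complex"

definition mat_alg :: "'a set \<Rightarrow> 'a cmat calg"
  where "mat_alg X =
    \<lparr>carrier = {M. \<forall>x y. x \<notin> X \<or> y \<notin> X \<longrightarrow> M x y = 0},
     monoid.mult = (\<lambda>M N x y. \<Sum>z\<in>X. M x z * N z y),
     monoid.one = (\<lambda>x y. if x \<in> X \<and> x = y then 1 else 0),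
     ring.zero = (\<lambda>x y. 0),
     ring.add = (\<lambda>M N x y. M x y + N x y),
     smult = (\<lambda>c M x y. c * M x y)\<rparr>"

text \<open>The matrix \<open>E\<^sub>Y\<close>; it lies in \<^term>\<open>mat_alg X\<close> when \<open>Y \<subseteq> X\<close>.\<close>

definition diag_proj :: "'a set \<Rightarrow> 'a cmat"
  where "diag_proj Y = (\<lambda>x y. if x \<in> Y \<and> x = y then 1 else 0)"


section \<open>Finite simple graphs\<close>

text \<open>A graph is given by its vertex set \<open>X\<close> and its set \<open>E\<close> of edges, each a set of two vertices.\<close>

definition adj_rel :: "'a set set \<Rightarrow> ('a \<times> 'a) set"
  where "adj_rel E = {(x, y). {x, y} \<in> E}"

definition finite_connected_simple_graph :: "'a set \<Rightarrow> 'a set set \<Rightarrow> bool"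
  where "finite_connected_simple_graph X E \<longleftrightarrow>
    finite X \<and> X \<noteq> {} \<and> (\<forall>e\<in>E. \<exists>x\<in>X. \<exists>y\<in>X. x \<noteq> y \<and> e = {x, y}) \<and>
    (\<forall>x\<in>X. \<forall>y\<in>X. (x, y) \<in> (adj_rel E)\<^sup>*)"

definition adj_matrix :: "'a set set \<Rightarrow> 'a cmat"
  where "adj_matrix E = (\<lambda>x y. if {x, y} \<in> E then 1 else 0)"

text \<open>
  The length of a shortest walk: \<open>(x, y) \<in> adj_rel E ^^ k\<close> says that there is a walk of length
  \<open>k\<close> from \<open>x\<close> to \<open>y\<close>. The value is meaningful only if \<open>x\<close> and \<open>y\<close> are connected.
\<close>

definition graph_dist :: "'a set set \<Rightarrow> 'a \<Rightarrow> 'a \<Rightarrow> nat"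
  where "graph_dist E x y = (LEAST k. (x, y) \<in> adj_rel E ^^ k)"

definition sphere_at :: "'a set \<Rightarrow> 'a set set \<Rightarrow> 'a \<Rightarrow> nat \<Rightarrow> 'a set"
  where "sphere_at X E x0 k = {x \<in> X. graph_dist E x0 x = k}"

definition eccentricity :: "'a set \<Rightarrow> 'a set set \<Rightarrow> 'a \<Rightarrow> nat"
  where "eccentricity X E x0 = Max (graph_dist E x0 ` X)"

text \<open>
  Automorphisms are permutations of \<open>X\<close>, extended by the identity outside \<open>X\<close> (which is part of
  the meaning of \<open>permutes\<close>).
\<close>

definition graph_aut :: "'a set \<Rightarrow> 'a set set \<Rightarrow> ('a \<Rightarrow> 'a) set"
  where "graph_aut X E =
    {\<sigma>. \<sigma> permutes X \<and> (\<forall>x\<in>X. \<forall>y\<in>X. {\<sigma> x, \<sigma> y} \<in> E \<longleftrightarrow> {x, y} \<in> E)}"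

definition aut_stabilizer :: "'a set \<Rightarrow> 'a set set \<Rightarrow> 'a \<Rightarrow> ('a \<Rightarrow> 'a) set"
  where "aut_stabilizer X E x0 = {\<sigma> \<in> graph_aut X E. \<sigma> x0 = x0}"

definition stabilizer_orbits :: "'a set \<Rightarrow> 'a set set \<Rightarrow> 'a \<Rightarrow> 'a set set"
  where "stabilizer_orbits X E x0 = {{\<sigma> x | \<sigma>. \<sigma> \<in> aut_stabilizer X E x0} | x. x \<in> X}"


section \<open>The four algebras of a graph with a base vertex\<close>

definition T1 :: "'a set \<Rightarrow> 'a set set \<Rightarrow> 'a \<Rightarrow> 'a cmat calg"
  where "T1 X E x0 = (mat_alg X)
    \<lparr>carrier := alg_gen (mat_alg X) {adj_matrix E, diag_proj {x0}}\<rparr>"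

definition T2 :: "'a set \<Rightarrow> 'a set set \<Rightarrow> 'a \<Rightarrow> 'a cmat calg"
  where "T2 X E x0 = (mat_alg X)
    \<lparr>carrier := alg_gen (mat_alg X)
      (insert (adj_matrix E)
        {diag_proj (sphere_at X E x0 k) | k. k \<le> eccentricity X E x0})\<rparr>"

definition T3 :: "'a set \<Rightarrow> 'a set set \<Rightarrow> 'a \<Rightarrow> 'a cmat calg"
  where "T3 X E x0 = (mat_alg X)
    \<lparr>carrier := alg_gen (mat_alg X)
      (insert (adj_matrix E) {diag_proj Y | Y. Y \<in> stabilizer_orbits X E x0})\<rparr>"

definition T4 :: "'a set \<Rightarrow> 'a set set \<Rightarrow> 'a \<Rightarrow> 'a cmat calg"
  where "T4 X E x0 = (mat_alg X)
    \<lparr>carrier := {M \<in> carrier (mat_alg X).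
      \<forall>x\<in>X. \<forall>y\<in>X. \<forall>\<sigma>\<in>aut_stabilizer X E x0. M (\<sigma> x) (\<sigma> y) = M x y}\<rparr>"


section \<open>The star graph\<close>

definition star_verts :: "nat \<Rightarrow> nat set"
  where "star_verts n = {1..n}"

definition star_edges :: "nat \<Rightarrow> nat set set"
  where "star_edges n = {{1, i} | i. i \<in> {2..n}}"

lemma star_graph: "finite_connected_simple_graph (star_verts n) (star_edges n)" if "n \<ge> 1"
proof -
  have to1: "(x, 1) \<in> (adj_rel (star_edges n))\<^sup>*"
    and from1: "(1, x) \<in> (adj_rel (star_edges n))\<^sup>*" if "x \<in> star_verts n" for x
  proof -
    have "x = 1 \<or> x \<in> {2..n}" using that by (auto simp: star_verts_def)
    then have "x = 1 \<or> {1, x} \<in> star_edges n" unfolding star_edges_def by blast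
    then show "(x, 1) \<in> (adj_rel (star_edges n))\<^sup>*" "(1, x) \<in> (adj_rel (star_edges n))\<^sup>*"
      by (auto simp: adj_rel_def insert_commute intro: r_into_rtrancl)
  qed
  have "\<exists>x\<in>star_verts n. \<exists>y\<in>star_verts n. x \<noteq> y \<and> e = {x, y}" if "e \<in> star_edges n" for e
  proof -
    from that obtain i where "i \<in> {2..n}" "e = {1, i}" by (auto simp: star_edges_def)
    then show ?thesis
      by (intro bexI[of _ 1] bexI[of _ i]) (auto simp: star_verts_def)
  qed
  moreover have "(x, y) \<in> (adj_rel (star_edges n))\<^sup>*"
    if "x \<in> star_verts n" "y \<in> star_verts n" for x y
    using to1[OF that(1)] from1[OF that(2)] by (rule rtrancl_trans)
  moreover have "finite (star_verts n)" "star_verts n \<noteq> {}"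
    using that by (auto simp: star_verts_def)
  ultimately show ?thesis
    unfolding finite_connected_simple_graph_def by blast
qed

end

theory Submission
  imports Defs
begin

text \<open>
  In any graph \<open>\<T>\<^sub>1\<close> is contained in \<open>\<T>\<^sub>2\<close> and \<open>\<T>\<^sub>3\<close>, and these are contained in \<open>\<T>\<^sub>4\<close>. For the star
  with centre \<open>1\<close> the stabilizer contains all transpositions of leaves, so a matrix in \<open>\<T>\<^sub>4\<close> has a
  constant first row and first column (away from the corner) and the leaf block \<open>d I + e J\<close>. With
  \<open>E = E\<^sub>1\<close> it equals \<open>a E + b E A + c A E + d (1 - E) + e A E A\<close>, hence lies in \<open>\<T>\<^sub>1\<close>, and the four
  algebras coincide. With \<open>m = n - 1\<close> leaves, such a matrix acts on the span of the centre and the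
  sum of the leaves by a \<open>2 \<times> 2\<close> matrix, and on the orthogonal complement by the scalar \<open>d\<close>; this is
  the isomorphism with \<open>M\<^sub>2(\<complex>) \<oplus> \<complex>\<close>.
\<close>

section \<open>The matrix algebra\<close>

lemma mat_alg_simps [simp]:
  "M \<in> carrier (mat_alg X) \<longleftrightarrow> (\<forall>x y. x \<notin> X \<or> y \<notin> X \<longrightarrow> M x y = 0)"
  "M \<otimes>\<^bsub>mat_alg X\<^esub> N = (\<lambda>x y. \<Sum>z\<in>X. M x z * N z y)"
  "\<one>\<^bsub>mat_alg X\<^esub> = diag_proj X"
  "\<zero>\<^bsub>mat_alg X\<^esub> = (\<lambda>x y. 0)"
  "M \<oplus>\<^bsub>mat_alg X\<^esub> N = (\<lambda>x y. M x y + N x y)"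
  "c \<odot>\<^bsub>mat_alg X\<^esub> M = (\<lambda>x y. c * M x y)"
  by (simp_all add: mat_alg_def diag_proj_def)

lemma ring_mat_alg:
  assumes "finite X"
  shows "ring (mat_alg X)"
proof (rule ringI)
  show "abelian_group (mat_alg X)"
  proof (rule abelian_groupI)
    fix M :: "'a cmat" assume "M \<in> carrier (mat_alg X)"
    then show "\<exists>N\<in>carrier (mat_alg X). N \<oplus>\<^bsub>mat_alg X\<^esub> M = \<zero>\<^bsub>mat_alg X\<^esub>"
      by (intro bexI[of _ "\<lambda>x y. - M x y"]) auto
  qed (auto simp: ac_simps)
  show "monoid (mat_alg X)"
  proof (rule monoidI)
    fix L M N :: "'a cmat"
    show "L \<otimes>\<^bsub>mat_alg X\<^esub> M \<otimes>\<^bsub>mat_alg X\<^esub> N = L \<otimes>\<^bsub>mat_alg X\<^esub> (M \<otimes>\<^bsub>mat_alg X\<^esub> N)"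
      by (simp add: sum_distrib_left sum_distrib_right mult.assoc fun_eq_iff)
        (intro allI sum.swap)
  next
    fix M :: "'a cmat" assume M: "M \<in> carrier (mat_alg X)"
    show "\<one>\<^bsub>mat_alg X\<^esub> \<otimes>\<^bsub>mat_alg X\<^esub> M = M"
    proof (intro ext)
      fix x y
      show "(\<one>\<^bsub>mat_alg X\<^esub> \<otimes>\<^bsub>mat_alg X\<^esub> M) x y = M x y"
        using M assms
        by (cases "x \<in> X")
          (auto simp: diag_proj_def if_distrib[of "\<lambda>t. t * _"] cong: if_cong)
    qed
    show "M \<otimes>\<^bsub>mat_alg X\<^esub> \<one>\<^bsub>mat_alg X\<^esub> = M"
      using M assms
      by (auto simp: diag_proj_def fun_eq_iff if_distrib[of "\<lambda>t. _ * t"] cong: if_cong conj_cong)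
  qed (auto simp: diag_proj_def)
qed (auto simp: algebra_simps sum.distrib)

text \<open>The additive inverse of a ring is given only by its characteristic property, so its
  entrywise form comes from uniqueness of inverses. Closure of subrings under negation relies on
  it.\<close>

lemma a_inv_mat_alg:
  assumes "finite X" "M \<in> carrier (mat_alg X)"
  shows "\<ominus>\<^bsub>mat_alg X\<^esub> M = (\<lambda>x y. - M x y)"
proof -
  interpret ring "mat_alg X" by (rule ring_mat_alg[OF assms(1)])
  show ?thesis
    by (rule minus_equality) (use assms(2) in auto)
qed

lemma alg_gen_subset: "unital_subalgebra B R \<Longrightarrow> S \<subseteq> B \<Longrightarrow> alg_gen R S \<subseteq> B"
  unfolding alg_gen_def by blast

lemma alg_gen_mono: "S \<subseteq> S' \<Longrightarrow> alg_gen R S \<subseteq> alg_gen R S'"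
  unfolding alg_gen_def by blast

section \<open>The chain of inclusions\<close>

lemma aut_stabilizerD:
  assumes "\<sigma> \<in> aut_stabilizer X E x0"
  shows "\<sigma> permutes X" "\<sigma> x0 = x0"
    "\<And>x y. x \<in> X \<Longrightarrow> y \<in> X \<Longrightarrow> {\<sigma> x, \<sigma> y} \<in> E \<longleftrightarrow> {x, y} \<in> E"
  using assms by (auto simp: aut_stabilizer_def graph_aut_def)

lemma id_in_aut_stabilizer: "id \<in> aut_stabilizer X E x0"
  by (simp add: aut_stabilizer_def graph_aut_def permutes_id)

lemma comp_in_aut_stabilizer:
  assumes "\<sigma> \<in> aut_stabilizer X E x0" "\<tau> \<in> aut_stabilizer X E x0"
  shows "\<sigma> \<circ> \<tau> \<in> aut_stabilizer X E x0"
  using assms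
  by (auto simp: aut_stabilizer_def graph_aut_def permutes_compose permutes_in_image)

text \<open>The edge condition is an equivalence, so applying it for \<open>\<sigma>\<close> at the
  preimages of two vertices gives the condition for the inverse.\<close>

lemma inv_in_aut_stabilizer:
  assumes "\<sigma> \<in> aut_stabilizer X E x0"
  shows "Hilbert_Choice.inv \<sigma> \<in> aut_stabilizer X E x0"
proof -
  note \<sigma> = aut_stabilizerD[OF assms]
  have p: "Hilbert_Choice.inv \<sigma> permutes X" by (rule permutes_inv[OF \<sigma>(1)])
  have "{Hilbert_Choice.inv \<sigma> x, Hilbert_Choice.inv \<sigma> y} \<in> E \<longleftrightarrow> {x, y} \<in> E"
    if "x \<in> X" "y \<in> X" for x y
    using \<sigma>(3)[of "Hilbert_Choice.inv \<sigma> x" "Hilbert_Choice.inv \<sigma> y"] that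
    by (simp add: permutes_in_image[OF p] permutes_inverses[OF \<sigma>(1)])
  moreover have "Hilbert_Choice.inv \<sigma> x0 = x0"
    using \<sigma>(2) permutes_inverses(2)[OF \<sigma>(1), of x0] by simp
  ultimately show ?thesis
    using p by (simp add: aut_stabilizer_def graph_aut_def)
qed

section \<open>Matrices invariant under permutations\<close>

text \<open>When \<open>G\<close> consists of permutations of \<open>X\<close>, this is the
  commutant of their permutation matrices.\<close>

definition invariant_mats :: "'a set \<Rightarrow> ('a \<Rightarrow> 'a) set \<Rightarrow> 'a cmat set"
  where "invariant_mats X G =
    {M \<in> carrier (mat_alg X). \<forall>x\<in>X. \<forall>y\<in>X. \<forall>\<sigma>\<in>G. M (\<sigma> x) (\<sigma> y) = M x y}"

text \<open>The point is the product: since \<open>\<sigma>\<close> permutes \<open>X\<close>, the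
  intermediate index \<open>z\<close> may be replaced by \<open>\<sigma> z\<close>, after which
  invariance of both factors applies.\<close>

lemma unital_subalgebra_invariant_mats:
  assumes "finite X" and G: "\<And>\<sigma>. \<sigma> \<in> G \<Longrightarrow> \<sigma> permutes X"
  shows "unital_subalgebra (invariant_mats X G) (mat_alg X)"
proof -
  interpret ring "mat_alg X" by (rule ring_mat_alg[OF assms(1)])
  have "subring (invariant_mats X G) (mat_alg X)"
  proof (rule subringI)
    show "\<one>\<^bsub>mat_alg X\<^esub> \<in> invariant_mats X G"
      using G by (auto simp: invariant_mats_def diag_proj_def permutes_in_image
          dest: permutes_inj[THEN injD])
  next
    fix M assume M: "M \<in> invariant_mats X G"
    then have "\<ominus>\<^bsub>mat_alg X\<^esub> M = (\<lambda>x y. - M x y)"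
      by (intro a_inv_mat_alg[OF assms(1)]) (simp add: invariant_mats_def)
    then show "\<ominus>\<^bsub>mat_alg X\<^esub> M \<in> invariant_mats X G"
      using M by (simp add: invariant_mats_def)
  next
    fix M N assume MN: "M \<in> invariant_mats X G" "N \<in> invariant_mats X G"
    have "(\<Sum>z\<in>X. M (\<sigma> x) z * N z (\<sigma> y)) = (\<Sum>z\<in>X. M x z * N z y)"
      if "\<sigma> \<in> G" "x \<in> X" "y \<in> X" for \<sigma> x y
    proof -
      have "(\<Sum>z\<in>X. M (\<sigma> x) z * N z (\<sigma> y)) = (\<Sum>z\<in>X. M (\<sigma> x) (\<sigma> z) * N (\<sigma> z) (\<sigma> y))"
        by (rule sum.reindex_bij_betw[symmetric])
          (rule permutes_imp_bij[OF G[OF that(1)]])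
      also have "\<dots> = (\<Sum>z\<in>X. M x z * N z y)"
        using MN that by (intro sum.cong) (auto simp: invariant_mats_def)
      finally show ?thesis .
    qed
    then show "M \<otimes>\<^bsub>mat_alg X\<^esub> N \<in> invariant_mats X G"
      using MN by (auto simp: invariant_mats_def)
    show "M \<oplus>\<^bsub>mat_alg X\<^esub> N \<in> invariant_mats X G"
      using MN by (auto simp: invariant_mats_def)
  qed (auto simp: invariant_mats_def)
  then show ?thesis
    by (auto simp: unital_subalgebra_def invariant_mats_def)
qed

text \<open>Stability of \<open>Y\<close> handles the diagonal entries; injectivity of
  \<open>\<sigma>\<close> keeps off-diagonal positions off the diagonal.\<close>

lemma diag_proj_in_invariant_mats:
  assumes "Y \<subseteq> X" and "\<And>\<sigma>. \<sigma> \<in> G \<Longrightarrow> \<sigma> permutes X"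
    and "\<And>\<sigma> x. \<sigma> \<in> G \<Longrightarrow> x \<in> X \<Longrightarrow> \<sigma> x \<in> Y \<longleftrightarrow> x \<in> Y"
  shows "diag_proj Y \<in> invariant_mats X G"
  using assms by (auto simp: invariant_mats_def diag_proj_def dest: permutes_inj[THEN injD])

lemma carrier_T4: "carrier (T4 X E x0) = invariant_mats X (aut_stabilizer X E x0)"
  by (simp add: T4_def invariant_mats_def)

section \<open>Distance from the base vertex\<close>

lemma relpow_adj_rel_aut:
  assumes "finite_connected_simple_graph X E" "\<sigma> \<in> aut_stabilizer X E x0"
    and "(x, y) \<in> adj_rel E ^^ k"
  shows "(\<sigma> x, \<sigma> y) \<in> adj_rel E ^^ k"
  using assms(3)
proof (induction k arbitrary: y)
  case (Suc k)
  then obtain z where z: "(x, z) \<in> adj_rel E ^^ k" "{z, y} \<in> E"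
    by (auto simp: adj_rel_def)
  \<comment> \<open>Automorphisms are controlled only on vertices, so the endpoints of the last edge
    are first placed in \<open>X\<close>.\<close>
  with assms(1) have "z \<in> X" "y \<in> X"
    unfolding finite_connected_simple_graph_def by (metis insert_iff singletonD doubleton_eq_iff)+
  with z aut_stabilizerD(3)[OF assms(2)] have "{\<sigma> z, \<sigma> y} \<in> E" by blast
  with Suc.IH[OF z(1)] show ?case by (auto simp: adj_rel_def)
qed simp

text \<open>The walks from \<open>x0\<close> to \<open>x\<close> and to \<open>\<sigma> x\<close>
  have the same lengths, by applying \<open>\<sigma>\<close> and its inverse; hence the two
  \<open>LEAST\<close> terms agree.\<close>

lemma graph_dist_aut:
  assumes "finite_connected_simple_graph X E" "\<sigma> \<in> aut_stabilizer X E x0"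
  shows "graph_dist E x0 (\<sigma> x) = graph_dist E x0 x"
proof -
  note \<sigma> = aut_stabilizerD[OF assms(2)]
  note \<tau> = inv_in_aut_stabilizer[OF assms(2)]
  have "(x0, \<sigma> x) \<in> adj_rel E ^^ k \<longleftrightarrow> (x0, x) \<in> adj_rel E ^^ k" for k
    using relpow_adj_rel_aut[OF assms, of x0 x k]
      relpow_adj_rel_aut[OF assms(1) \<tau>, of x0 "\<sigma> x" k]
    by (auto simp: permutes_inverses[OF \<sigma>(1)] \<sigma>(2) aut_stabilizerD(2)[OF \<tau>])
  then show ?thesis by (simp add: graph_dist_def)
qed

lemma sphere_at_0:
  assumes "finite_connected_simple_graph X E" and x0: "x0 \<in> X"
  shows "sphere_at X E x0 0 = {x0}"
proof -
  have "x = x0" if x: "x \<in> X" and "graph_dist E x0 x = 0" for x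
  proof -
    \<comment> \<open>A \<open>LEAST\<close> value of 0 yields a walk of length 0 only once some
      walk is known to exist; connectedness supplies one.\<close>
    have "(x0, x) \<in> (adj_rel E)\<^sup>*"
      using assms x
      by (simp add: finite_connected_simple_graph_def)
    then have "\<exists>k. (x0, x) \<in> adj_rel E ^^ k" by (simp add: rtrancl_power)
    then have "(x0, x) \<in> adj_rel E ^^ graph_dist E x0 x"
      unfolding graph_dist_def by (rule LeastI_ex)
    with that show ?thesis by simp
  qed
  moreover have "graph_dist E x0 x0 = 0"
    unfolding graph_dist_def by (rule Least_equality) auto
  ultimately show ?thesis using x0 by (auto simp: sphere_at_def)
qed

section \<open>Inclusions for an arbitrary graph\<close>

context
  fixes X :: "'a set" and E :: "'a set set" and x0 :: 'a
  assumes graph: "finite_connected_simple_graph X E" and x0: "x0 \<in> X"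
begin

lemma adj_matrix_in_T4: "adj_matrix E \<in> carrier (T4 X E x0)"
proof -
  have "x \<in> X \<and> y \<in> X" if "{x, y} \<in> E" for x y
    using graph that
    unfolding finite_connected_simple_graph_def by (metis insert_iff singletonD doubleton_eq_iff)
  then show ?thesis
    by (auto simp: carrier_T4 invariant_mats_def adj_matrix_def aut_stabilizerD(3))
qed

lemma unital_subalgebra_T4: "unital_subalgebra (carrier (T4 X E x0)) (mat_alg X)"
  unfolding carrier_T4
  by (rule unital_subalgebra_invariant_mats)
    (use graph in \<open>auto simp: finite_connected_simple_graph_def dest: aut_stabilizerD(1)\<close>)

text \<open>The generator for \<open>x0\<close> is the projection onto the sphere of radius
  0.\<close>

lemma T1_subset_T2: "carrier (T1 X E x0) \<subseteq> carrier (T2 X E x0)"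
  using sphere_at_0[OF graph x0]
  by (auto simp: T1_def T2_def intro!: alg_gen_mono exI[of _ 0])

text \<open>The base vertex forms an orbit of its own stabilizer.\<close>

lemma T1_subset_T3: "carrier (T1 X E x0) \<subseteq> carrier (T3 X E x0)"
proof -
  have "{\<sigma> x0 | \<sigma>. \<sigma> \<in> aut_stabilizer X E x0} = {x0}"
    using id_in_aut_stabilizer[of X E x0] by (auto simp: aut_stabilizerD(2)) (metis id_apply)
  with x0 have "{x0} \<in> stabilizer_orbits X E x0"
    unfolding stabilizer_orbits_def by blast
  then show ?thesis
    by (auto simp: T1_def T3_def intro!: alg_gen_mono)
qed

text \<open>Automorphisms fixing \<open>x0\<close> preserve the distance to it, so each sphere is
  stable under the stabilizer.\<close>

lemma T2_subset_T4: "carrier (T2 X E x0) \<subseteq> carrier (T4 X E x0)"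
proof -
  have "diag_proj (sphere_at X E x0 k) \<in> carrier (T4 X E x0)" for k
    unfolding carrier_T4
    by (rule diag_proj_in_invariant_mats)
      (auto simp: sphere_at_def aut_stabilizerD(1) graph_dist_aut[OF graph]
        permutes_in_image[OF aut_stabilizerD(1)])
  then have "alg_gen (mat_alg X) (insert (adj_matrix E)
      {diag_proj (sphere_at X E x0 k) | k. k \<le> eccentricity X E x0}) \<subseteq> carrier (T4 X E x0)"
    using adj_matrix_in_T4 by (intro alg_gen_subset[OF unital_subalgebra_T4]) blast
  then show ?thesis by (simp add: T2_def)
qed

text \<open>Orbits are stable because the stabilizer is closed under composition; its inverses give
  the converse direction of the equivalence.\<close>

lemma T3_subset_T4: "carrier (T3 X E x0) \<subseteq> carrier (T4 X E x0)"
proof -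
  have "diag_proj Y \<in> carrier (T4 X E x0)" if Y: "Y \<in> stabilizer_orbits X E x0" for Y
  proof -
    obtain y where y: "y \<in> X" "Y = {\<sigma> y | \<sigma>. \<sigma> \<in> aut_stabilizer X E x0}"
      using Y by (auto simp: stabilizer_orbits_def)
    have fwd: "\<sigma> x \<in> Y" if \<sigma>: "\<sigma> \<in> aut_stabilizer X E x0" and x: "x \<in> Y" for \<sigma> x
    proof -
      obtain \<tau> where "\<tau> \<in> aut_stabilizer X E x0" "x = \<tau> y" using x y(2) by blast
      with comp_in_aut_stabilizer[OF \<sigma>] show ?thesis
        unfolding y(2) by (auto intro!: exI[of _ "\<sigma> \<circ> \<tau>"])
    qed
    have "\<sigma> x \<in> Y \<longleftrightarrow> x \<in> Y" if \<sigma>: "\<sigma> \<in> aut_stabilizer X E x0" for \<sigma> x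
      using fwd[OF \<sigma>, of x] fwd[OF inv_in_aut_stabilizer[OF \<sigma>], of "\<sigma> x"]
      by (auto simp: permutes_inverses[OF aut_stabilizerD(1)[OF \<sigma>]])
    then show ?thesis
      unfolding carrier_T4
      by (intro diag_proj_in_invariant_mats)
        (auto simp: y aut_stabilizerD(1) permutes_in_image[OF aut_stabilizerD(1)])
  qed
  then have "alg_gen (mat_alg X) (insert (adj_matrix E)
      {diag_proj Y | Y. Y \<in> stabilizer_orbits X E x0}) \<subseteq> carrier (T4 X E x0)"
    using adj_matrix_in_T4 by (intro alg_gen_subset[OF unital_subalgebra_T4]) blast
  then show ?thesis by (simp add: T3_def)
qed

end

section \<open>The star graph\<close>

text \<open>Writing the leaf block as \<open>d\<close> times the identity plus \<open>e\<close>
  times the all-ones matrix makes \<open>d\<close> the eigenvalue on leaf vectors with coordinate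
  sum 0, so it is multiplicative. The diagonal leaf entry is \<open>d + e\<close>.\<close>

definition star_mat :: "nat \<Rightarrow> complex \<Rightarrow> complex \<Rightarrow> complex \<Rightarrow> complex \<Rightarrow> complex \<Rightarrow> nat cmat"
  where "star_mat n a b c d e = (\<lambda>x y.
    if x \<notin> {1..n} \<or> y \<notin> {1..n} then 0
    else if x = 1 then (if y = 1 then a else b)
    else if y = 1 then c else (if x = y then d else 0) + e)"

lemma edge_star_iff:
  "{x, y} \<in> star_edges n \<longleftrightarrow> x = 1 \<and> y \<in> {2..n} \<or> y = 1 \<and> x \<in> {2..n}"
  by (auto simp: star_edges_def doubleton_eq_iff)

lemma transpose_in_aut_stabilizer_star:
  assumes "u \<in> {2..n}" "v \<in> {2..n}"
  shows "transpose u v \<in> aut_stabilizer (star_verts n) (star_edges n) 1"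
proof -
  have "transpose u v permutes star_verts n"
    using assms by (intro permutes_swap_id) (auto simp: star_verts_def)
  then show ?thesis
    using assms
    by (auto simp: aut_stabilizer_def graph_aut_def edge_star_iff transpose_def)
qed

text \<open>Products of leaf transpositions have five orbits on pairs of vertices, represented by
  (1,1), (1,2), (2,1), (2,2) and (2,3); an invariant matrix is determined by these entries.\<close>

lemma T4_star_eq_star_mat:
  assumes n: "n \<ge> 4" and M: "M \<in> carrier (T4 (star_verts n) (star_edges n) 1)"
  shows "M = star_mat n (M 1 1) (M 1 2) (M 2 1) (M 2 2 - M 2 3) (M 2 3)"
proof -
  have inv: "M (transpose u v x) (transpose u v y) = M x y"
    if "u \<in> {2..n}" "v \<in> {2..n}" "x \<in> {1..n}" "y \<in> {1..n}" for u v x y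
    using M that transpose_in_aut_stabilizer_star[OF that(1,2)]
    by (auto simp: T4_def star_verts_def)
  have row: "M 1 y = M 1 2" if "y \<in> {2..n}" for y
    using inv[of 2 y 1 2] that n by (auto simp: transpose_def)
  have col: "M y 1 = M 2 1" if "y \<in> {2..n}" for y
    using inv[of 2 y 2 1] that n by (auto simp: transpose_def)
  have diag: "M y y = M 2 2" if "y \<in> {2..n}" for y
    using inv[of 2 y 2 2] that n by (auto simp: transpose_def)
  have left: "M x y = M x' y"
    if "x \<in> {2..n}" "x' \<in> {2..n}" "y \<in> {2..n}" "x \<noteq> y" "x' \<noteq> y" for x x' y
    using inv[of x' x x' y] that by (auto simp: transpose_def)
  have right: "M x y = M x y'"
    if "x \<in> {2..n}" "y \<in> {2..n}" "y' \<in> {2..n}" "x \<noteq> y" "x \<noteq> y'" for x y y'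
    using inv[of y' y x y'] that by (auto simp: transpose_def)
  have off: "M x y = M 2 3" if xy: "x \<in> {2..n}" "y \<in> {2..n}" "x \<noteq> y" for x y
  proof -
    \<comment> \<open>A single transposition changes one index while the other stays fixed, so the
      route from \<open>(x, y)\<close> to \<open>(2, 3)\<close> passes through \<open>(x, w)\<close>
      and \<open>(2, w)\<close>. This needs a leaf \<open>w\<close> other than \<open>x\<close> and
      2: it is 3, or 4 if \<open>x = 3\<close>, whence \<open>n \<ge> 4\<close>.\<close>
    define w :: nat where "w = (if x = 3 then 4 else 3)"
    have w: "w \<in> {2..n}" "w \<noteq> x" "w \<noteq> 2" using n by (auto simp: w_def)
    have "M x y = M x w" using xy w by (intro right) auto
    also have "\<dots> = M 2 w" using xy w n by (intro left) auto
    also have "\<dots> = M 2 3" using w n by (intro right) auto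
    finally show ?thesis .
  qed
  show ?thesis
  proof (intro ext)
    fix x y
    show "M x y = star_mat n (M 1 1) (M 1 2) (M 2 1) (M 2 2 - M 2 3) (M 2 3) x y"
    proof (cases "x \<in> {1..n} \<and> y \<in> {1..n}")
      case False
      with M show ?thesis by (auto simp: T4_def star_mat_def star_verts_def)
    next
      case True
      then consider "x = 1" "y = 1" | "x = 1" "y \<in> {2..n}" | "x \<in> {2..n}" "y = 1"
        | "x \<in> {2..n}" "y \<in> {2..n}" by force
      then show ?thesis
        using row[of y] col[of x] diag[of y] off[of x y] True
        by cases (auto simp: star_mat_def)
    qed
  qed
qed

lemma star_mat_in_T1:
  assumes n: "n \<ge> 1"
  shows "star_mat n a b c d e \<in> carrier (T1 (star_verts n) (star_edges n) 1)"
proof -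
  let ?R = "mat_alg (star_verts n)"
  define A where "A = adj_matrix (star_edges n)"
  define P where "P = (diag_proj {1} :: nat cmat)"
  have "star_mat n a b c d e \<in> B"
    if B: "unital_subalgebra B ?R" and gen: "{A, P} \<subseteq> B" for B
  proof -
    have sub: "subring B ?R" and sm: "\<And>k M. M \<in> B \<Longrightarrow> k \<odot>\<^bsub>?R\<^esub> M \<in> B"
      using B by (auto simp: unital_subalgebra_def)
    note cl = subringE(3)[OF sub] subringE(6)[OF sub] subringE(7)[OF sub] sm
    have AP: "A \<in> B" "P \<in> B" using gen by auto
    have PM: "P \<otimes>\<^bsub>?R\<^esub> M = (\<lambda>x y. if x = 1 then M 1 y else 0)" for M
      using n by (auto simp: P_def diag_proj_def star_verts_def fun_eq_iff
          if_distrib[of "\<lambda>t. t * _"] cong: if_cong)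
    have MP: "M \<otimes>\<^bsub>?R\<^esub> P = (\<lambda>x y. if y = 1 then M x 1 else 0)" for M
      using n by (auto simp: P_def diag_proj_def star_verts_def fun_eq_iff
          if_distrib[of "\<lambda>t. _ * t"] cong: if_cong conj_cong)
    have APA: "A \<otimes>\<^bsub>?R\<^esub> (P \<otimes>\<^bsub>?R\<^esub> A) = (\<lambda>x y. A x 1 * A 1 y)"
      unfolding PM using n
      by (auto simp: star_verts_def fun_eq_iff if_distrib[of "\<lambda>t. _ * t"] cong: if_cong)
    \<comment> \<open>\<open>P A\<close> is the leaf part of the first row, \<open>A P\<close> that
      of the first column, and \<open>1 - P\<close> the identity on leaves. \<open>A P A\<close> is
      column 1 times row 1 of \<open>A\<close>, hence all ones on the leaf block. Subtraction is
      written with the scalar -1, so that closure under sums, products and scalars suffices.\<close>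
    have "star_mat n a b c d e =
      a \<odot>\<^bsub>?R\<^esub> P \<oplus>\<^bsub>?R\<^esub> b \<odot>\<^bsub>?R\<^esub> (P \<otimes>\<^bsub>?R\<^esub> A) \<oplus>\<^bsub>?R\<^esub> c \<odot>\<^bsub>?R\<^esub> (A \<otimes>\<^bsub>?R\<^esub> P)
      \<oplus>\<^bsub>?R\<^esub> d \<odot>\<^bsub>?R\<^esub> (\<one>\<^bsub>?R\<^esub> \<oplus>\<^bsub>?R\<^esub> (-1) \<odot>\<^bsub>?R\<^esub> P) \<oplus>\<^bsub>?R\<^esub> e \<odot>\<^bsub>?R\<^esub> (A \<otimes>\<^bsub>?R\<^esub> (P \<otimes>\<^bsub>?R\<^esub> A))"
      unfolding APA unfolding PM MP using n
      by (auto simp: fun_eq_iff star_mat_def A_def P_def adj_matrix_def edge_star_iff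
          diag_proj_def star_verts_def)
    also have "\<dots> \<in> B" by (intro cl AP)
    finally show ?thesis .
  qed
  then show ?thesis
    by (simp add: T1_def alg_gen_def A_def P_def)
qed

text \<open>The chain of inclusions from \<open>T1\<close> through \<open>T2\<close> or
  \<open>T3\<close> to \<open>T4\<close> is squeezed between \<open>C\<close> and
  \<open>C\<close>.\<close>

lemma T_star_eq:
  assumes n: "n \<ge> 4"
  defines "C \<equiv> {star_mat n a b c d e | a b c d e. True}"
  shows "carrier (T1 (star_verts n) (star_edges n) 1) = C"
    "carrier (T2 (star_verts n) (star_edges n) 1) = C"
    "carrier (T3 (star_verts n) (star_edges n) 1) = C"
    "carrier (T4 (star_verts n) (star_edges n) 1) = C"
proof -
  have g: "finite_connected_simple_graph (star_verts n) (star_edges n)" "1 \<in> star_verts n"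
    using star_graph[of n] n by (auto simp: star_verts_def)
  have "C \<subseteq> carrier (T1 (star_verts n) (star_edges n) 1)"
    using n star_mat_in_T1 by (auto simp: C_def)
  moreover have "carrier (T4 (star_verts n) (star_edges n) 1) \<subseteq> C"
    using T4_star_eq_star_mat[OF n] unfolding C_def by blast
  ultimately show "carrier (T1 (star_verts n) (star_edges n) 1) = C"
    "carrier (T2 (star_verts n) (star_edges n) 1) = C"
    "carrier (T3 (star_verts n) (star_edges n) 1) = C"
    "carrier (T4 (star_verts n) (star_edges n) 1) = C"
    using T1_subset_T2[OF g] T1_subset_T3[OF g] T2_subset_T4[OF g] T3_subset_T4[OF g]
    by auto
qed

section \<open>The isomorphism\<close>

text \<open>Split the summation index into the centre and the \<open>m\<close> leaves. In the leaf
  block the all-ones matrix squares to \<open>m\<close> times itself, and the centre contributes the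
  constant \<open>c * b'\<close>.\<close>

lemma star_mat_mult:
  assumes n: "n \<ge> 1"
  defines "m \<equiv> of_nat (n - 1) :: complex"
  shows "star_mat n a b c d e \<otimes>\<^bsub>mat_alg (star_verts n)\<^esub> star_mat n a' b' c' d' e' =
    star_mat n (a * a' + m * b * c') (a * b' + b * (d' + m * e')) (c * a' + (d + m * e) * c')
      (d * d') (c * b' + d * e' + e * d' + m * e * e')"
proof -
  have split: "{1..n} = insert 1 {2..n}" using n by auto
  have sum_leaf: "(\<Sum>z\<in>{2..n}. ((if x = z then p else 0) + q) * ((if z = y then p' else 0) + q')) =
      (if x = y then p * p' else 0) + p * q' + q * p' + m * q * q'"
    if "x \<in> {2..n}" "y \<in> {2..n}" for x y :: nat and p q p' q' :: complex
    using that
    by (simp add: distrib_left distrib_right sum.distrib m_def if_distrib[of "\<lambda>t. t * _"]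
        if_distrib[of "\<lambda>t. _ * t"] cong: if_cong)
  have sum_r: "(\<Sum>z\<in>{2..n}. q * ((if z = y then p' else 0) + q')) = q * p' + m * q * q'"
    if "y \<in> {2..n}" for y :: nat and q p' q' :: complex
    using that
    by (simp add: distrib_left sum.distrib m_def if_distrib[of "\<lambda>t. _ * t"] cong: if_cong)
  have sum_l: "(\<Sum>z\<in>{2..n}. ((if x = z then p else 0) + q) * q') = p * q' + m * q * q'"
    if "x \<in> {2..n}" for x :: nat and p q q' :: complex
    using that
    by (simp add: distrib_right sum.distrib m_def if_distrib[of "\<lambda>t. t * _"] cong: if_cong)
  show ?thesis
  proof (intro ext)
    fix x y
    let ?M = "star_mat n a b c d e" and ?N = "star_mat n a' b' c' d' e'"
    have eq: "(?M \<otimes>\<^bsub>mat_alg (star_verts n)\<^esub> ?N) x y = ?M x 1 * ?N 1 y + (\<Sum>z\<in>{2..n}. ?M x z * ?N z y)"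
      unfolding star_verts_def mat_alg_simps split by (subst sum.insert) auto
    consider "x \<notin> {1..n} \<or> y \<notin> {1..n}" | "x = 1" "y = 1" | "x = 1" "y \<in> {2..n}"
      | "x \<in> {2..n}" "y = 1" | "x \<in> {2..n}" "y \<in> {2..n}" by force
    then show "(?M \<otimes>\<^bsub>mat_alg (star_verts n)\<^esub> ?N) x y =
      star_mat n (a * a' + m * b * c') (a * b' + b * (d' + m * e')) (c * a' + (d + m * e) * c')
      (d * d') (c * b' + d * e' + e * d' + m * e * e') x y"
    proof cases
      case 1
      then show ?thesis by (auto simp: star_verts_def star_mat_def)
    next
      case 2
      have "(\<Sum>z\<in>{2..n}. ?M x z * ?N z y) = (\<Sum>z\<in>{2..n}. b * c')"
        using 2 n by (intro sum.cong) (auto simp: star_mat_def)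
      with 2 n show ?thesis unfolding eq by (simp add: star_mat_def m_def)
    next
      case 3
      have "(\<Sum>z\<in>{2..n}. ?M x z * ?N z y) = (\<Sum>z\<in>{2..n}. b * ((if z = y then d' else 0) + e'))"
        using 3 n by (intro sum.cong) (auto simp: star_mat_def)
      with 3 n show ?thesis unfolding eq sum_r[OF 3(2)]
        by (auto simp: star_mat_def algebra_simps)
    next
      case 4
      have "(\<Sum>z\<in>{2..n}. ?M x z * ?N z y) = (\<Sum>z\<in>{2..n}. ((if x = z then d else 0) + e) * c')"
        using 4 n by (intro sum.cong) (auto simp: star_mat_def)
      with 4 n show ?thesis unfolding eq sum_l[OF 4(1)]
        by (auto simp: star_mat_def algebra_simps)
    next
      case 5
      have "(\<Sum>z\<in>{2..n}. ?M x z * ?N z y) =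
          (\<Sum>z\<in>{2..n}. ((if x = z then d else 0) + e) * ((if z = y then d' else 0) + e'))"
        using 5 n by (intro sum.cong) (auto simp: star_mat_def)
      with 5 n show ?thesis unfolding eq sum_leaf[OF 5]
        by (auto simp: star_mat_def algebra_simps)
    qed
  qed
qed

lemma star_mat_add:
  "star_mat n a b c d e \<oplus>\<^bsub>mat_alg X\<^esub> star_mat n a' b' c' d' e' =
    star_mat n (a + a') (b + b') (c + c') (d + d') (e + e')"
  by (auto simp: star_mat_def fun_eq_iff)

lemma star_mat_smult:
  "k \<odot>\<^bsub>mat_alg X\<^esub> star_mat n a b c d e = star_mat n (k * a) (k * b) (k * c) (k * d) (k * e)"
  by (auto simp: star_mat_def fun_eq_iff algebra_simps)

lemma star_mat_one: "\<one>\<^bsub>mat_alg (star_verts n)\<^esub> = star_mat n 1 0 0 1 0"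
  by (auto simp: star_mat_def fun_eq_iff diag_proj_def star_verts_def)

section \<open>The target algebra in coordinates\<close>

definition mat2 :: "complex \<Rightarrow> complex \<Rightarrow> complex \<Rightarrow> complex \<Rightarrow> nat cmat"
  where "mat2 p q r s = (\<lambda>i j.
    if i = 1 \<and> j = 1 then p else if i = 1 \<and> j = 2 then q
    else if i = 2 \<and> j = 1 then r else if i = 2 \<and> j = 2 then s else 0)"

lemma atLeastAtMost_1_2: "{1..2::nat} = {1, 2}"
  by auto

lemma mat2_in_carrier: "mat2 p q r s \<in> carrier (mat_alg {1..2})"
  by (auto simp: mat2_def)

lemma mat2_exhaust:
  assumes "M \<in> carrier (mat_alg {1..2::nat})"
  obtains p q r s where "M = mat2 p q r s"
proof
  show "M = mat2 (M 1 1) (M 1 2) (M 2 1) (M 2 2)"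
    using assms unfolding atLeastAtMost_1_2 by (auto simp: mat2_def fun_eq_iff)
qed

lemma mat2_ops:
  "mat2 p q r s \<otimes>\<^bsub>mat_alg {1..2}\<^esub> mat2 p' q' r' s' =
    mat2 (p * p' + q * r') (p * q' + q * s') (r * p' + s * r') (r * q' + s * s')"
  "mat2 p q r s \<oplus>\<^bsub>mat_alg {1..2}\<^esub> mat2 p' q' r' s' = mat2 (p + p') (q + q') (r + r') (s + s')"
  "k \<odot>\<^bsub>mat_alg {1..2}\<^esub> mat2 p q r s = mat2 (k * p) (k * q) (k * r) (k * s)"
  "\<one>\<^bsub>mat_alg {1..2}\<^esub> = mat2 1 0 0 1"
  unfolding atLeastAtMost_1_2 by (auto simp: mat2_def fun_eq_iff diag_proj_def)

lemma mat2_eq_iff: "mat2 p q r s = mat2 p' q' r' s' \<longleftrightarrow> p = p' \<and> q = q' \<and> r = r' \<and> s = s'"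
proof
  assume "mat2 p q r s = mat2 p' q' r' s'"
  then have "mat2 p q r s i j = mat2 p' q' r' s' i j" for i j by simp
  from this[of 1 1] this[of 1 2] this[of 2 1] this[of 2 2]
  show "p = p' \<and> q = q' \<and> r = r' \<and> s = s'" by (simp add: mat2_def)
qed simp

lemma direct_sum_simps:
  "carrier (R \<oplus>\<^sub>\<complex> S) = carrier R \<times> carrier S"
  "(a, b) \<otimes>\<^bsub>R \<oplus>\<^sub>\<complex> S\<^esub> (a', b') = (a \<otimes>\<^bsub>R\<^esub> a', b \<otimes>\<^bsub>S\<^esub> b')"
  "(a, b) \<oplus>\<^bsub>R \<oplus>\<^sub>\<complex> S\<^esub> (a', b') = (a \<oplus>\<^bsub>R\<^esub> a', b \<oplus>\<^bsub>S\<^esub> b')"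
  "\<one>\<^bsub>R \<oplus>\<^sub>\<complex> S\<^esub> = (\<one>\<^bsub>R\<^esub>, \<one>\<^bsub>S\<^esub>)"
  "k \<odot>\<^bsub>R \<oplus>\<^sub>\<complex> S\<^esub> (a, b) = (k \<odot>\<^bsub>R\<^esub> a, k \<odot>\<^bsub>S\<^esub> b)"
  by (simp_all add: direct_sum_def ring.defs RDirProd_def DirProd_def monoid.defs)

lemma complex_alg_simps:
  "carrier complex_alg = UNIV" "a \<otimes>\<^bsub>complex_alg\<^esub> b = a * b" "a \<oplus>\<^bsub>complex_alg\<^esub> b = a + b"
  "\<one>\<^bsub>complex_alg\<^esub> = 1" "k \<odot>\<^bsub>complex_alg\<^esub> a = k * a"
  by (simp_all add: complex_alg_def)

section \<open>Construction of the isomorphism\<close>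

text \<open>The first component is the matrix of the action in the basis formed by the centre and
  the average of the leaves; averaging puts the factor \<open>n - 1\<close> on the lower left entry.
  The second is the eigenvalue \<open>d\<close> on leaf vectors with sum 0.\<close>

definition star_iso :: "nat \<Rightarrow> nat cmat \<Rightarrow> nat cmat \<times> complex"
  where "star_iso n M =
    (mat2 (M 1 1) (M 1 2) (of_nat (n - 1) * M 2 1) (M 2 2 - M 2 3 + of_nat (n - 1) * M 2 3),
     M 2 2 - M 2 3)"

text \<open>For \<open>n \<ge> 3\<close> the indices 2 and 3 are distinct leaves, so the entry at
  (2,3) is \<open>e\<close> and its difference from the entry at (2,2) recovers
  \<open>d\<close>.\<close>

lemma star_iso_star_mat:
  assumes "n \<ge> 3"
  shows "star_iso n (star_mat n a b c d e) =
    (mat2 a b (of_nat (n - 1) * c) (d + of_nat (n - 1) * e), d)"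
  using assms by (simp add: star_iso_def star_mat_def)

lemma star_algebra_iso:
  assumes n: "n \<ge> 3"
  shows "(mat_alg (star_verts n))\<lparr>carrier := {star_mat n a b c d e | a b c d e. True}\<rparr>
    \<cong>\<^sub>\<complex> mat_alg {1..2::nat} \<oplus>\<^sub>\<complex> complex_alg"
proof -
  define C where "C = {star_mat n a b c d e | a b c d e. True}"
  let ?R = "mat_alg (star_verts n)" and ?S = "mat_alg {1..2::nat} \<oplus>\<^sub>\<complex> complex_alg"
  define m where "m = (of_nat (n - 1) :: complex)"
  \<comment> \<open>Both \<open>c\<close> and \<open>e\<close> enter the image multiplied by
    \<open>m\<close>; injectivity cancels this factor and surjectivity divides by it.\<close>
  have m: "m \<noteq> 0" using n by (simp add: m_def)
  have n1: "n \<ge> 1" using n by simp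
  note iso = star_iso_star_mat[OF n, folded m_def]
  note ds = direct_sum_simps complex_alg_simps mat2_ops
  have CE: "\<exists>a b c d e. M = star_mat n a b c d e" if "M \<in> C" for M
    using that by (auto simp: C_def)
  have hom: "star_iso n \<in> ring_hom (?R\<lparr>carrier := C\<rparr>) ?S"
  proof (rule ring_hom_memI)
    fix M assume "M \<in> carrier (?R\<lparr>carrier := C\<rparr>)"
    then have "M \<in> C" by simp
    then obtain a b c d e where "M = star_mat n a b c d e" using CE by blast
    then show "star_iso n M \<in> carrier ?S"
      using mat2_in_carrier by (simp only: iso direct_sum_simps complex_alg_simps mem_Times_iff) simp
  next
    fix M N assume "M \<in> carrier (?R\<lparr>carrier := C\<rparr>)" "N \<in> carrier (?R\<lparr>carrier := C\<rparr>)"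
    then have "M \<in> C" "N \<in> C" by simp_all
    then obtain a b c d e a' b' c' d' e' where
      MN: "M = star_mat n a b c d e" "N = star_mat n a' b' c' d' e'" using CE by meson
    \<comment> \<open>Replacing the carrier leaves the operations unchanged, so the identities are
      computed in the full matrix algebra and then transferred.\<close>
    have "star_iso n (M \<otimes>\<^bsub>?R\<^esub> N) = star_iso n M \<otimes>\<^bsub>?S\<^esub> star_iso n N"
      unfolding MN star_mat_mult[OF n1, folded m_def] iso ds
      by (simp add: mat2_eq_iff algebra_simps)
    then show "star_iso n (M \<otimes>\<^bsub>?R\<lparr>carrier := C\<rparr>\<^esub> N) = star_iso n M \<otimes>\<^bsub>?S\<^esub> star_iso n N"
      by simp
    have "star_iso n (M \<oplus>\<^bsub>?R\<^esub> N) = star_iso n M \<oplus>\<^bsub>?S\<^esub> star_iso n N"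
      unfolding MN star_mat_add iso ds by (simp add: mat2_eq_iff algebra_simps)
    then show "star_iso n (M \<oplus>\<^bsub>?R\<lparr>carrier := C\<rparr>\<^esub> N) = star_iso n M \<oplus>\<^bsub>?S\<^esub> star_iso n N"
      by simp
  next
    have "star_iso n \<one>\<^bsub>?R\<^esub> = \<one>\<^bsub>?S\<^esub>"
      unfolding star_mat_one iso ds by simp
    then show "star_iso n \<one>\<^bsub>?R\<lparr>carrier := C\<rparr>\<^esub> = \<one>\<^bsub>?S\<^esub>" by simp
  qed
  have "bij_betw (star_iso n) C (carrier ?S)"
  proof (rule bij_betw_imageI)
    show "inj_on (star_iso n) C"
    proof (rule inj_onI)
      fix M N assume "M \<in> C" "N \<in> C" and eq: "star_iso n M = star_iso n N"
      then obtain a b c d e a' b' c' d' e' where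
        MN: "M = star_mat n a b c d e" "N = star_mat n a' b' c' d' e'" using CE by meson
      show "M = N" using eq m unfolding MN iso by (auto simp: mat2_eq_iff)
    qed
    show "star_iso n ` C = carrier ?S"
    proof
      show "star_iso n ` C \<subseteq> carrier ?S"
        using hom by (auto simp: ring_hom_def)
      show "carrier ?S \<subseteq> star_iso n ` C"
      proof
        fix w assume "w \<in> carrier ?S"
        then obtain M z where w: "w = (M, z)" "M \<in> carrier (mat_alg {1..2})"
          unfolding direct_sum_simps by blast
        from w(2) obtain p q r s where M: "M = mat2 p q r s" by (rule mat2_exhaust)
        \<comment> \<open>The witness solves \<open>m * c = r\<close>, \<open>d = z\<close> and
          \<open>d + m * e = s\<close>.\<close>
        have "w = star_iso n (star_mat n p q (r / m) z ((s - z) / m))"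
          unfolding w(1) M iso using m by simp
        moreover have "star_mat n p q (r / m) z ((s - z) / m) \<in> C"
          unfolding C_def by blast
        ultimately show "w \<in> star_iso n ` C" by blast
      qed
    qed
  qed
  with hom have ring: "star_iso n \<in> ring_iso (?R\<lparr>carrier := C\<rparr>) ?S"
    by (simp add: ring_iso_def)
  have "star_iso n (k \<odot>\<^bsub>?R\<^esub> M) = k \<odot>\<^bsub>?S\<^esub> star_iso n M" if M: "M \<in> C" for k M
  proof -
    obtain a b c d e where M: "M = star_mat n a b c d e" using CE[OF M] by blast
    show ?thesis
      unfolding M star_mat_smult iso ds by (simp add: mat2_eq_iff algebra_simps)
  qed
  with ring show ?thesis
    unfolding C_def[symmetric] calg_iso_def by (intro bexI[of _ "star_iso n"]) simp_all
qed

theorem theorem7p5: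
  fixes n :: nat
  assumes "n \<ge> 4"
  shows "T1 (star_verts n) (star_edges n) 1 \<cong>\<^sub>\<complex> mat_alg {1..2::nat} \<oplus>\<^sub>\<complex> complex_alg \<and>
         T2 (star_verts n) (star_edges n) 1 \<cong>\<^sub>\<complex> mat_alg {1..2::nat} \<oplus>\<^sub>\<complex> complex_alg \<and>
         T3 (star_verts n) (star_edges n) 1 \<cong>\<^sub>\<complex> mat_alg {1..2::nat} \<oplus>\<^sub>\<complex> complex_alg \<and>
         T4 (star_verts n) (star_edges n) 1 \<cong>\<^sub>\<complex> mat_alg {1..2::nat} \<oplus>\<^sub>\<complex> complex_alg"
proof -
  note eq = T_star_eq[OF assms]
  have n: "n \<ge> 3" using assms by simp
  \<comment> \<open>Each of the four algebras is the matrix algebra with another carrier, so equal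
    carriers make them the same record and one isomorphism serves for all.\<close>
  have carrier_upd: "T = (mat_alg X)\<lparr>carrier := C\<rparr>"
    if "T = (mat_alg X)\<lparr>carrier := B\<rparr>" "carrier T = C" for T :: "nat cmat calg" and X B C
    using that by simp
  show ?thesis
    unfolding carrier_upd[OF T1_def eq(1)] carrier_upd[OF T2_def eq(2)]
      carrier_upd[OF T3_def eq(3)] carrier_upd[OF T4_def eq(4)]
    by (intro conjI star_algebra_iso[OF n])
qed

end
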